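(* The synergy value $\chi$ is the only measure of synergy in $\Psi$ that satisfies all of the properties $P_5$ (Symmetric-Synergy), $P_6$ (Null-Synergy), $P_7$ (Dummy-Synergy), $P_8$ (Normalized-Synergy) and $P_9$ (Additive-Synergy). That is, $\chi$ satisfies $P_5$–$P_9$, and if $\psi\in\Psi$ satisfies $P_5$–$P_9$ then $\psi=\chi$, i.e. $\psi^N_v(C)=\chi^N_v(C)$ for every game $(N,v)\in\mathscr{G}$ and every $C\subseteq N$.
   Context: Fix a universe of players $\mathscr{N}$. A (characteristic-function) game is a pair $(N,v)$, where $N\subseteq\mathscr{N}$ is a finite nonempty set of players, $n=|N|$, and $v:2^N\to\mathbb{R}$ satisfies $v(\emptyset)=0$. Subsets of $N$ are called coalitions. $\mathscr{G}$ is the set of all games. For $C\subseteq N$, the sub-game $(C,v)$ is the game with player set $C$ and $v$ restricted to $2^C$. For two games $(N,v),(N,w)$, the games $(N,v+w)$ and $(N,v-w)$ are defined by pointwise sum and difference. In a game $(N,v)$: - players $i,j\in N$ are symmetric if $v(C\cup\{i\})=v(C\cup\{j\})$ for every $C\subseteq N\setminus\{i,j\}$; - $i\in N$ is a null player if $v(C\cup\{i\})=v(C)$ for all $C\subseteq N$; - $i\in N$ is a dummy player if $v(C\cup\{i\})=v(C)+v(\{i\})$ for all $C\subseteq N\setminus\{i\}$. A game of dummies is a game in which every player is a dummy player. The Shapley value of $i\in N$ in $(N,v)$ is $$\phi_i(N,v)=\sum_{C\subseteq N\setminus\{i\}}\frac{|C|!\,(n-|C|-1)!}{n!}\big(v(C\cup\{i\})-v(C)\big).$$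 For a sub-game $(C,v)$, $\phi_i(C,v)$ is given by the same formula with $N$ replaced by $C$ and $n$ by $|C|$. A measure of synergy is a function $\psi$ assigning a real number $\psi^N_v(C)$ to each game $(N,v)\in\mathscr{G}$ and coalition $C\subseteq N$, with $\psi^N_v(\emptyset)=0$ always. $\Psi$ is the set of all such measures. The synergy value $\chi\in\Psi$ is $$\chi^N_v(C)=v(C)-\sum_{i\in C}\overline{\phi}_i(N,v),\qquad \overline{\phi}_i(N,v)=2^{1-n}\sum_{C\subseteq N:\,i\in C}\phi_i(C,v).$$ Properties of $\psi\in\Psi$: - $P_5$: for every game $(N,v)\in\mathscr{G}$ and every pair of symmetric players $i,j$ in it, $\psi^N_v(C\cup\{i\})=\psi^N_v(C\cup\{j\})$ for all $C\subseteq N\setminus\{i,j\}$. - $P_6$: for every game $(N,v)\in\mathscr{G}$ and every null player $i$ in it, $\psi^N_v(C)=\psi^N_v(C\cup\{i\})$ for all $C\subseteq N$. - $P_7$: for every game $(N,v)\in\mathscr{G}$, $(N,v-\psi^N_v)$ is a game of dummies. - $P_8$: for every game $(N,v)\in\mathscr{G}$, $\sum_{C\subseteq N}\psi^N_v(C)=0$. - $P_9$: for every pair of games $(N,v),(N,w)$ with the same player set and every $C\subseteq N$, $\psi^N_v(C)+\psi^N_w(C)=\psi^N_{v+w}(C)$. *)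

theory Defs
  imports Complex_Main "HOL-Library.FuncSet"
begin

text \<open>
  The universe of players is the type \<open>'a\<close>.  A characteristic function on \<open>N\<close> is an
  extensional function on \<open>Pow N\<close>, so that a pair \<open>(N, v)\<close> carries no information about
  \<open>v\<close> outside \<open>Pow N\<close>; hence a measure of synergy cannot depend on such values either.
\<close>

definition games :: "('a set \<times> ('a set \<Rightarrow> real)) set" where
  "games = {(N, v). finite N \<and> N \<noteq> {} \<and> v \<in> extensional (Pow N) \<and> v {} = 0}"

definition subgame :: "'a set \<Rightarrow> ('a set \<Rightarrow> real) \<Rightarrow> 'a set \<Rightarrow> real" where
  "subgame C v = restrict v (Pow C)"

definition game_add ::
  "'a set \<Rightarrow> ('a set \<Rightarrow> real) \<Rightarrow> ('a set \<Rightarrow> real) \<Rightarrow> 'a set \<Rightarrow> real" where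
  "game_add N v w = (\<lambda>C\<in>Pow N. v C + w C)"

definition game_diff ::
  "'a set \<Rightarrow> ('a set \<Rightarrow> real) \<Rightarrow> ('a set \<Rightarrow> real) \<Rightarrow> 'a set \<Rightarrow> real" where
  "game_diff N v w = (\<lambda>C\<in>Pow N. v C - w C)"

definition symmetric_players :: "'a set \<Rightarrow> ('a set \<Rightarrow> real) \<Rightarrow> 'a \<Rightarrow> 'a \<Rightarrow> bool" where
  "symmetric_players N v i j \<longleftrightarrow>
     i \<in> N \<and> j \<in> N \<and> (\<forall>C. C \<subseteq> N - {i, j} \<longrightarrow> v (C \<union> {i}) = v (C \<union> {j}))"

definition null_player :: "'a set \<Rightarrow> ('a set \<Rightarrow> real) \<Rightarrow> 'a \<Rightarrow> bool" where
  "null_player N v i \<longleftrightarrow> i \<in> N \<and> (\<forall>C. C \<subseteq> N \<longrightarrow> v (C \<union> {i}) = v C)"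

definition dummy_player :: "'a set \<Rightarrow> ('a set \<Rightarrow> real) \<Rightarrow> 'a \<Rightarrow> bool" where
  "dummy_player N v i \<longleftrightarrow>
     i \<in> N \<and> (\<forall>C. C \<subseteq> N - {i} \<longrightarrow> v (C \<union> {i}) = v C + v {i})"

definition game_of_dummies :: "'a set \<Rightarrow> ('a set \<Rightarrow> real) \<Rightarrow> bool" where
  "game_of_dummies N v \<longleftrightarrow> (N, v) \<in> games \<and> (\<forall>i\<in>N. dummy_player N v i)"

definition shapley :: "'a set \<Rightarrow> ('a set \<Rightarrow> real) \<Rightarrow> 'a \<Rightarrow> real" where
  "shapley N v i =
     (\<Sum>C\<in>Pow (N - {i}).
        fact (card C) * fact (card N - card C - 1) / fact (card N) * (v (C \<union> {i}) - v C))"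

definition avg_shapley :: "'a set \<Rightarrow> ('a set \<Rightarrow> real) \<Rightarrow> 'a \<Rightarrow> real" where
  "avg_shapley N v i =
     2 powi (1 - int (card N)) * (\<Sum>C\<in>{C. C \<subseteq> N \<and> i \<in> C}. shapley C (subgame C v) i)"

text \<open>
  A measure \<open>\<psi>\<close> maps \<open>N\<close>, \<open>v\<close> and \<open>C\<close> to \<open>\<psi>\<^sup>N\<^sub>v(C)\<close>.  Only its values at \<open>(N, v) \<in> games\<close>
  and \<open>C \<subseteq> N\<close> are meaningful, and two measures are the same if they agree there.
\<close>

type_synonym 'a measure_fun = "'a set \<Rightarrow> ('a set \<Rightarrow> real) \<Rightarrow> 'a set \<Rightarrow> real"

definition synergy_measures :: "'a measure_fun set" where
  "synergy_measures = {\<psi>. \<forall>(N, v)\<in>games. \<psi> N v {} = 0}"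

definition synergy_value :: "'a measure_fun" where
  "synergy_value N v C = v C - (\<Sum>i\<in>C. avg_shapley N v i)"

definition symmetric_synergy :: "'a measure_fun \<Rightarrow> bool" where
  "symmetric_synergy \<psi> \<longleftrightarrow>
     (\<forall>(N, v)\<in>games. \<forall>i j. symmetric_players N v i j \<longrightarrow>
        (\<forall>C. C \<subseteq> N - {i, j} \<longrightarrow> \<psi> N v (C \<union> {i}) = \<psi> N v (C \<union> {j})))"

definition null_synergy :: "'a measure_fun \<Rightarrow> bool" where
  "null_synergy \<psi> \<longleftrightarrow>
     (\<forall>(N, v)\<in>games. \<forall>i. null_player N v i \<longrightarrow>
        (\<forall>C. C \<subseteq> N \<longrightarrow> \<psi> N v C = \<psi> N v (C \<union> {i})))"

definition dummy_synergy :: "'a measure_fun \<Rightarrow> bool" where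
  "dummy_synergy \<psi> \<longleftrightarrow> (\<forall>(N, v)\<in>games. game_of_dummies N (game_diff N v (\<psi> N v)))"

definition normalized_synergy :: "'a measure_fun \<Rightarrow> bool" where
  "normalized_synergy \<psi> \<longleftrightarrow> (\<forall>(N, v)\<in>games. (\<Sum>C\<in>Pow N. \<psi> N v C) = 0)"

definition additive_synergy :: "'a measure_fun \<Rightarrow> bool" where
  "additive_synergy \<psi> \<longleftrightarrow>
     (\<forall>N v w. (N, v) \<in> games \<longrightarrow> (N, w) \<in> games \<longrightarrow>
        (\<forall>C. C \<subseteq> N \<longrightarrow> \<psi> N v C + \<psi> N w C = \<psi> N (game_add N v w) C))"

end

theory Submission
  imports Defs "HOL-Combinatorics.Transposition"
begin

text \<open>
  Property \<open>P\<^sub>7\<close> says that \<open>\<psi>\<^sup>N\<^sub>v(C) = v(C) - (\<Sum>i\<in>C. a\<^sub>i)\<close> for numbers \<open>a\<^sub>i\<close> depending on the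
  game.  In a multiple of the unanimity game on \<open>T\<close>, \<open>P\<^sub>6\<close> forces \<open>a\<^sub>i = 0\<close> outside \<open>T\<close>, \<open>P\<^sub>5\<close>
  makes \<open>a\<close> constant on \<open>T\<close>, and \<open>P\<^sub>8\<close> fixes the constant.  Since these games span all games,
  \<open>P\<^sub>9\<close> yields uniqueness.  For \<open>\<chi>\<close> itself, \<open>P\<^sub>8\<close> is efficiency of the Shapley value summed over
  all subgames.
\<close>

section \<open>Sums over coalitions\<close>

lemma sum_coalitions_containing:
  assumes "i \<in> N"
  shows "(\<Sum>C\<in>{C. C \<subseteq> N \<and> i \<in> C}. g C) = (\<Sum>C\<in>Pow (N - {i}). g (insert i C))"
  by (rule sum.reindex_bij_witness[where i = "insert i" and j = "\<lambda>C. C - {i}"])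
    (use assms in \<open>auto simp: insert_absorb\<close>)

lemma sum_players_coalitions_swap:
  assumes "finite N"
  shows "(\<Sum>i\<in>N. \<Sum>C\<in>{C. C \<subseteq> N \<and> i \<in> C}. g i C) = (\<Sum>C\<in>Pow N. \<Sum>i\<in>C. g i C)"
proof -
  have "(\<Sum>i\<in>N. \<Sum>C\<in>{C. C \<subseteq> N \<and> i \<in> C}. g i C) = (\<Sum>i\<in>N. \<Sum>C | C \<in> Pow N \<and> i \<in> C. g i C)"
    by simp
  also have "\<dots> = (\<Sum>C\<in>Pow N. \<Sum>i | i \<in> N \<and> i \<in> C. g i C)"
    using assms by (intro sum.swap_restrict) auto
  also have "\<dots> = (\<Sum>C\<in>Pow N. \<Sum>i\<in>C. g i C)"
    by (intro sum.cong) auto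
  finally show ?thesis .
qed

text \<open>Each player of \<open>N\<close> lies in exactly \<open>2 ^ (card N - 1)\<close>
  coalitions.\<close>

lemma sum_coalitions_additive:
  fixes a :: "'a \<Rightarrow> real"
  assumes "finite N"
  shows "(\<Sum>C\<in>Pow N. \<Sum>i\<in>C. a i) = 2 ^ (card N - 1) * (\<Sum>i\<in>N. a i)"
proof -
  have "(\<Sum>C\<in>Pow N. \<Sum>i\<in>C. a i) = (\<Sum>i\<in>N. \<Sum>C\<in>{C. C \<subseteq> N \<and> i \<in> C}. a i)"
    using sum_players_coalitions_swap[OF assms, of "\<lambda>i C. a i"] by simp
  also have "\<dots> = (\<Sum>i\<in>N. 2 ^ (card N - 1) * a i)"
    using assms by (intro sum.cong refl) (simp add: sum_coalitions_containing card_Pow del: sum_constant, simp add: card_Pow)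
  finally show ?thesis by (simp add: sum_distrib_left)
qed

section \<open>The Shapley value and its average over subgames\<close>

lemma shapley_cong:
  assumes "i \<in> N" "\<And>S. S \<subseteq> N \<Longrightarrow> v S = w S"
  shows "shapley N v i = shapley N w i"
  unfolding shapley_def using assms(1)
  by (intro sum.cong refl arg_cong2[where f = "(*)"] arg_cong2[where f = "(-)"] assms(2)) auto

lemma shapley_subgame: "i \<in> C \<Longrightarrow> shapley C (subgame C v) i = shapley C v i"
  by (rule shapley_cong) (auto simp: subgame_def)

lemma avg_shapley_eq:
  "avg_shapley N v i = 2 powi (1 - int (card N)) * (\<Sum>C\<in>{C. C \<subseteq> N \<and> i \<in> C}. shapley C v i)"
  by (simp add: avg_shapley_def shapley_subgame)

lemma shapley_add: "shapley N (\<lambda>S. v S + w S) i = shapley N v i + shapley N w i"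
  unfolding shapley_def sum.distrib[symmetric] distrib_left[symmetric]
  by (simp add: add_diff_add)

lemma avg_shapley_game_add:
  "avg_shapley N (game_add N v w) i = avg_shapley N v i + avg_shapley N w i"
proof -
  have "shapley C (game_add N v w) i = shapley C v i + shapley C w i" if "C \<subseteq> N" "i \<in> C" for C
    unfolding shapley_add[symmetric] by (rule shapley_cong) (use that in \<open>auto simp: game_add_def\<close>)
  then show ?thesis
    by (simp add: avg_shapley_eq sum.distrib distrib_left)
qed

lemma avg_shapley_null_player:
  assumes "null_player N v i"
  shows "avg_shapley N v i = 0"
proof -
  have "v (S \<union> {i}) = v S" if "S \<subseteq> N" for S
    using assms that by (simp add: null_player_def)
  then have "shapley C v i = 0" if "C \<subseteq> N" for C
    unfolding shapley_def using that by (intro sum.neutral) auto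
  then show ?thesis by (simp add: avg_shapley_eq)
qed

text \<open>Relabelling by an injection matches the subsets of \<open>N - {i}\<close> with those of
  the image and keeps all cardinalities, hence all weights.\<close>

lemma shapley_image:
  assumes "inj \<sigma>"
  shows "shapley (\<sigma> ` N) v (\<sigma> i) = shapley N (\<lambda>S. v (\<sigma> ` S)) i"
proof -
  have inj: "inj_on ((`) \<sigma>) X" for X
    using assms by (simp add: inj_on_def inj_image_eq_iff)
  have "Pow (\<sigma> ` N - {\<sigma> i}) = (`) \<sigma> ` Pow (N - {i})"
    using assms by (simp add: image_Pow_surj image_set_diff)
  then show ?thesis
    using assms by (simp add: shapley_def sum.reindex[OF inj] card_image inj_on_subset[OF assms])
qed

text \<open>The transposition fixes a coalition containing both or neither of \<open>i\<close> and
  \<open>j\<close>. Otherwise it trades one for the other next to a coalition avoiding both, where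
  the symmetry hypothesis applies.\<close>

lemma symmetric_players_transpose:
  assumes sym: "symmetric_players N v i j" and S: "S \<subseteq> N"
  shows "v (transpose i j ` S) = v S"
proof -
  have swap: "v (insert i C) = v (insert j C)" if "C \<subseteq> N - {i, j}" for C
    using sym that by (auto simp: symmetric_players_def)
  consider "i \<in> S \<longleftrightarrow> j \<in> S" | "i \<in> S" "j \<notin> S" | "i \<notin> S" "j \<in> S" by blast
  then show ?thesis
  proof cases
    case 1
    then show ?thesis by simp
  next
    case 2
    then have "transpose i j ` S = insert j (S - {i})"
      by (force simp: transpose_def image_iff)
    moreover have "v (insert i (S - {i})) = v (insert j (S - {i}))"
      using S 2 by (intro swap) auto
    ultimately show ?thesis using 2 by (simp add: insert_absorb)
  next
    case 3
    then have "transpose i j ` S = insert i (S - {j})"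
      by (force simp: transpose_def image_iff)
    moreover have "v (insert i (S - {j})) = v (insert j (S - {j}))"
      using S 3 by (intro swap) auto
    ultimately show ?thesis using 3 by (simp add: insert_absorb)
  qed
qed

text \<open>The transposition pairs the coalitions containing \<open>i\<close> with those containing
  \<open>j\<close>. As it leaves all values of \<open>v\<close> unchanged, paired subgames give
  \<open>i\<close> and \<open>j\<close> the same Shapley value.\<close>

lemma avg_shapley_symmetric_players:
  assumes sym: "symmetric_players N v i j"
  shows "avg_shapley N v i = avg_shapley N v j"
proof -
  let ?\<sigma> = "transpose i j"
  have ij: "i \<in> N" "j \<in> N" using sym by (auto simp: symmetric_players_def)
  have sub: "?\<sigma> ` C \<subseteq> N" if "C \<subseteq> N" for C
    using that ij by (auto simp: transpose_def)
  have "(\<Sum>C\<in>{C. C \<subseteq> N \<and> i \<in> C}. shapley C v i) = (\<Sum>C\<in>{C. C \<subseteq> N \<and> j \<in> C}. shapley C v j)"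
  proof (rule sum.reindex_bij_witness[where i = "(`) ?\<sigma>" and j = "(`) ?\<sigma>"])
    fix C assume C: "C \<in> {C. C \<subseteq> N \<and> i \<in> C}"
    have "shapley (?\<sigma> ` C) v j = shapley C (\<lambda>S. v (?\<sigma> ` S)) i"
      using shapley_image[of ?\<sigma> C v i] by simp
    also have "\<dots> = shapley C v i"
      by (rule shapley_cong) (use C sym in \<open>auto intro!: symmetric_players_transpose\<close>)
    finally show "shapley (?\<sigma> ` C) v j = shapley C v i" .
    show "?\<sigma> ` C \<in> {C. C \<subseteq> N \<and> j \<in> C}" using C sub by force
  next
    fix C assume C: "C \<in> {C. C \<subseteq> N \<and> j \<in> C}"
    then show "?\<sigma> ` C \<in> {C. C \<subseteq> N \<and> i \<in> C}" using sub by force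
  qed (simp_all add: image_image)
  then show ?thesis by (simp add: avg_shapley_eq)
qed

text \<open>Collect the coefficient of each \<open>v S\<close> in the total of all marginal
  contributions: members of \<open>S\<close> contribute positively, outsiders negatively, and the
  two cancel unless \<open>S\<close> is empty or all of \<open>N\<close>.\<close>

lemma shapley_efficient:
  assumes fin: "finite N" and v0: "v {} = 0"
  shows "(\<Sum>i\<in>N. shapley N v i) = v N"
proof (cases "N = {}")
  case True
  then show ?thesis using v0 by simp
next
  case False
  let ?n = "card N"
  define p :: "nat \<Rightarrow> real" where "p k = fact k * fact (?n - k - 1) / fact ?n" for k
  have npos: "0 < ?n" using False fin by (simp add: card_gt_0_iff)
  \<comment> \<open>\<open>S\<close> arises as \<open>insert i C\<close> once for each member
    \<open>i\<close>, with \<open>C\<close> one smaller than \<open>S\<close>.\<close>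
  have gain: "(\<Sum>i\<in>N. \<Sum>C\<in>Pow (N - {i}). p (card C) * v (insert i C))
      = (\<Sum>S\<in>Pow N. real (card S) * p (card S - 1) * v S)"
  proof -
    have "(\<Sum>i\<in>N. \<Sum>C\<in>Pow (N - {i}). p (card C) * v (insert i C))
        = (\<Sum>i\<in>N. \<Sum>S\<in>{S. S \<subseteq> N \<and> i \<in> S}. p (card S - 1) * v S)"
    proof (rule sum.cong[OF refl])
      fix i assume i: "i \<in> N"
      show "(\<Sum>C\<in>Pow (N - {i}). p (card C) * v (insert i C))
          = (\<Sum>S\<in>{S. S \<subseteq> N \<and> i \<in> S}. p (card S - 1) * v S)"
        unfolding sum_coalitions_containing[OF i]
      proof (rule sum.cong[OF refl])
        fix C assume "C \<in> Pow (N - {i})"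
        then have "finite C" "i \<notin> C" using fin by (auto intro: finite_subset)
        then show "p (card C) * v (insert i C) = p (card (insert i C) - 1) * v (insert i C)"
          by simp
      qed
    qed
    also have "\<dots> = (\<Sum>S\<in>Pow N. \<Sum>i\<in>S. p (card S - 1) * v S)"
      by (rule sum_players_coalitions_swap[OF fin])
    finally show ?thesis by (simp add: mult.assoc)
  qed
  \<comment> \<open>\<open>S\<close> arises as \<open>C\<close> once for each player outside
    it.\<close>
  have loss: "(\<Sum>i\<in>N. \<Sum>C\<in>Pow (N - {i}). p (card C) * v C)
      = (\<Sum>S\<in>Pow N. real (?n - card S) * p (card S) * v S)"
  proof -
    have "(\<Sum>i\<in>N. \<Sum>C\<in>Pow (N - {i}). p (card C) * v C)
        = (\<Sum>i\<in>N. \<Sum>C | C \<in> Pow N \<and> i \<notin> C. p (card C) * v C)"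
      by (intro sum.cong refl) auto
    also have "\<dots> = (\<Sum>C\<in>Pow N. \<Sum>i | i \<in> N \<and> i \<notin> C. p (card C) * v C)"
      using fin by (intro sum.swap_restrict) auto
    also have "\<dots> = (\<Sum>C\<in>Pow N. real (?n - card C) * p (card C) * v C)"
    proof (rule sum.cong[OF refl])
      fix C assume "C \<in> Pow N"
      then have "card {i \<in> N. i \<notin> C} = ?n - card C"
        using fin card_Diff_subset[of C N] by (auto simp: set_diff_eq intro: finite_subset)
      then show "(\<Sum>i | i \<in> N \<and> i \<notin> C. p (card C) * v C) = real (?n - card C) * p (card C) * v C"
        by simp
    qed
    finally show ?thesis .
  qed
  \<comment> \<open>For \<open>0 < s < n\<close> both products of factor and weight equal
    \<open>s! (n - s)! / n!\<close>. At the ends the truncated subtractions are harmless: their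
    terms carry the factor 0. For \<open>S = N\<close> the first coefficient is
    \<open>n (n - 1)! / n! = 1\<close>.\<close>
  have coeff: "real (card S) * p (card S - 1) * v S - real (?n - card S) * p (card S) * v S
      = (if S = N then v N else 0)" if "S \<in> Pow N" for S
  proof (cases "S = {} \<or> S = N")
    case True
    then show ?thesis
      using False v0 npos fact_reduce[OF npos, where ?'a = real] by (auto simp: p_def)
  next
    case False
    then have "0 < card S" "card S < ?n"
      using that fin psubset_card_mono[of N S]
      by (auto simp: card_gt_0_iff intro: finite_subset)
    \<comment> \<open>Writing the sizes as successors eliminates truncated subtraction, so that the
      factorials unfold.\<close>
    then obtain s r where s: "card S = Suc s" and r: "?n = card S + Suc r"
      using less_imp_Suc_add not0_implies_Suc by (metis add_Suc_right not_less0)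
    have "real (card S) * p (card S - 1) = real (?n - card S) * p (card S)"
      unfolding p_def r s by (simp add: field_simps)
    then show ?thesis using False by simp
  qed
  have "(\<Sum>i\<in>N. shapley N v i)
      = (\<Sum>i\<in>N. \<Sum>C\<in>Pow (N - {i}). p (card C) * v (insert i C)) -
        (\<Sum>i\<in>N. \<Sum>C\<in>Pow (N - {i}). p (card C) * v C)"
    by (simp add: shapley_def p_def right_diff_distrib sum_subtractf)
  also have "\<dots> = (\<Sum>S\<in>Pow N. if S = N then v N else 0)"
    unfolding gain loss sum_subtractf[symmetric] by (rule sum.cong[OF refl coeff])
  also have "\<dots> = v N" using fin by simp
  finally show ?thesis .
qed

text \<open>The averaging factor cancels the number of coalitions containing a given player.
  Swapping the sums then leaves, for each \<open>C\<close>, the total of the Shapley values in its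
  subgame, which efficiency evaluates to \<open>v C\<close>.\<close>

lemma sum_coalitions_avg_shapley:
  assumes "(N, v) \<in> games"
  shows "(\<Sum>C\<in>Pow N. \<Sum>i\<in>C. avg_shapley N v i) = (\<Sum>C\<in>Pow N. v C)"
proof -
  have fin: "finite N" and v0: "v {} = 0" and npos: "0 < card N"
    using assms by (auto simp: games_def card_gt_0_iff)
  have pow: "2 ^ (card N - 1) * 2 powi (1 - int (card N)) = (1 :: real)"
  proof -
    have "1 - int (card N) = - int (card N - 1)" using npos by simp
    then show ?thesis by (simp only: power_int_minus power_int_of_nat) simp
  qed
  have "(\<Sum>C\<in>Pow N. \<Sum>i\<in>C. avg_shapley N v i)
      = 2 ^ (card N - 1) * 2 powi (1 - int (card N)) *
        (\<Sum>i\<in>N. \<Sum>C\<in>{C. C \<subseteq> N \<and> i \<in> C}. shapley C v i)"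
    by (simp add: sum_coalitions_additive[OF fin] avg_shapley_eq sum_distrib_left mult.assoc)
  also have "\<dots> = (\<Sum>C\<in>Pow N. \<Sum>i\<in>C. shapley C v i)"
    by (simp only: pow mult_1_left sum_players_coalitions_swap[OF fin])
  also have "\<dots> = (\<Sum>C\<in>Pow N. v C)"
    using fin v0 by (intro sum.cong refl shapley_efficient) (auto intro: finite_subset)
  finally show ?thesis .
qed

section \<open>Properties of the synergy value\<close>

lemma synergy_value_synergy_measures: "synergy_value \<in> synergy_measures"
  by (auto simp: synergy_measures_def synergy_value_def games_def)

lemma synergy_value_symmetric: "symmetric_synergy synergy_value"
proof -
  have "synergy_value N v (C \<union> {i}) = synergy_value N v (C \<union> {j})"
    if "(N, v) \<in> games" "symmetric_players N v i j" "C \<subseteq> N - {i, j}" for N v i j and C :: "'a set"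
  proof -
    have "finite C" "i \<notin> C" "j \<notin> C"
      using that by (auto simp: games_def intro: finite_subset)
    then show ?thesis
      using that avg_shapley_symmetric_players[OF that(2)]
      by (auto simp: synergy_value_def symmetric_players_def)
  qed
  then show ?thesis by (auto simp: symmetric_synergy_def)
qed

lemma synergy_value_null: "null_synergy synergy_value"
proof -
  have "synergy_value N v C = synergy_value N v (C \<union> {i})"
    if "(N, v) \<in> games" "null_player N v i" "C \<subseteq> N" for N v i and C :: "'a set"
  proof -
    have "finite C" using that by (auto simp: games_def intro: finite_subset)
    then show ?thesis
      using that avg_shapley_null_player[OF that(2)]
      by (auto simp: synergy_value_def null_player_def sum.insert_if)
  qed
  then show ?thesis by (auto simp: null_synergy_def)
qed

text \<open>The difference is a sum of fixed numbers over the members of a coalition, so each player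
  adds the same amount to every coalition not containing it.\<close>

lemma synergy_value_dummy: "dummy_synergy synergy_value"
proof -
  have "game_of_dummies N (game_diff N v (synergy_value N v))"
    if "(N, v) \<in> games" for N :: "'a set" and v
  proof -
    have diff: "game_diff N v (synergy_value N v) = (\<lambda>C\<in>Pow N. \<Sum>i\<in>C. avg_shapley N v i)"
      by (simp add: game_diff_def synergy_value_def)
    have "finite C" if "C \<subseteq> N - {i}" for C i
      using \<open>(N, v) \<in> games\<close> that by (auto simp: games_def intro: finite_subset)
    then show ?thesis
      using that unfolding diff
      by (auto simp: game_of_dummies_def games_def dummy_player_def sum.insert_if)
  qed
  then show ?thesis by (auto simp: dummy_synergy_def)
qed

lemma synergy_value_normalized: "normalized_synergy synergy_value"
  by (auto simp: normalized_synergy_def synergy_value_def sum_subtractf sum_coalitions_avg_shapley)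

lemma synergy_value_additive: "additive_synergy synergy_value"
proof -
  have "synergy_value N v C + synergy_value N w C = synergy_value N (game_add N v w) C"
    if "C \<subseteq> N" for N v w and C :: "'a set"
    using that
    by (simp add: synergy_value_def avg_shapley_game_add sum.distrib) (simp add: game_add_def)
  then show ?thesis by (simp add: additive_synergy_def)
qed

section \<open>Uniqueness\<close>

text \<open>The factor \<open>c\<close> is built in because additivity of a measure does not by
  itself give compatibility with real multiples.\<close>

definition unanimity_game :: "'a set \<Rightarrow> 'a set \<Rightarrow> real \<Rightarrow> 'a set \<Rightarrow> real" where
  "unanimity_game N T c = (\<lambda>S\<in>Pow N. if T \<subseteq> S then c else 0)"

lemma unanimity_game_games:
  "finite N \<Longrightarrow> N \<noteq> {} \<Longrightarrow> T \<noteq> {} \<Longrightarrow> (N, unanimity_game N T c) \<in> games"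
  by (simp add: games_def unanimity_game_def)

text \<open>
  Subtracting \<open>v T\<close> times the unanimity game on a minimal coalition \<open>T\<close> of an upward closed
  family supporting \<open>v\<close> removes \<open>T\<close> from that family.
\<close>

lemma games_unanimity_induct [consumes 1, case_names unanimity add]:
  assumes v: "(N, v) \<in> games"
    and unanimity: "\<And>T c. T \<subseteq> N \<Longrightarrow> T \<noteq> {} \<Longrightarrow> P (unanimity_game N T c)"
    and add: "\<And>u w. (N, u) \<in> games \<Longrightarrow> (N, w) \<in> games \<Longrightarrow> P u \<Longrightarrow> P w \<Longrightarrow> P (game_add N u w)"
  shows "P v"
proof -
  have N: "finite N" "N \<noteq> {}" using v by (auto simp: games_def)
  \<comment> \<open>The induction is on the size of the upward closed family \<open>F\<close>
    outside which \<open>v\<close> vanishes.\<close>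
  have "P v" if "F \<subseteq> Pow N - {{}}" "(N, v) \<in> games"
    "\<And>S T. S \<in> F \<Longrightarrow> S \<subseteq> T \<Longrightarrow> T \<subseteq> N \<Longrightarrow> T \<in> F"
    "\<And>S. S \<subseteq> N \<Longrightarrow> S \<notin> F \<Longrightarrow> v S = 0" for F v
    using that
  proof (induction "card F" arbitrary: F v rule: less_induct)
    case less
    note F = less.prems(1) and v = less.prems(2) and up = less.prems(3) and supp = less.prems(4)
    have finF: "finite F" using F N(1) by (meson finite_Diff finite_Pow_iff finite_subset)
    show ?case
    proof (cases "F = {}")
      case True
      \<comment> \<open>The zero game is a unanimity game with factor 0; \<open>N\<close> serves as
        a nonempty coalition.\<close>
      then have "v = unanimity_game N N 0"
        using v supp by (auto simp: games_def unanimity_game_def extensional_def fun_eq_iff)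
      then show ?thesis using unanimity[of N 0] N(2) by simp
    next
      case False
      with finF obtain T where T: "T \<in> F" and min: "\<And>S. S \<in> F \<Longrightarrow> S \<subseteq> T \<Longrightarrow> S = T"
        using finite_has_minimal[of F] by metis
      let ?u = "unanimity_game N T (v T)"
      define w where "w = game_diff N v ?u"
      have T': "T \<subseteq> N" "T \<noteq> {}" using T F by auto
      have u: "(N, ?u) \<in> games" by (rule unanimity_game_games[OF N T'(2)])
      have w: "(N, w) \<in> games" using u v by (simp add: w_def game_diff_def games_def)
      have "P w"
      proof (rule less.hyps[of "F - {T}"])
        show "card (F - {T}) < card F" using finF T by (rule card_Diff1_less)
        show "F - {T} \<subseteq> Pow N - {{}}" using F by blast
        \<comment> \<open>Upward closure survives the removal of \<open>T\<close>: by minimality no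
          other member of \<open>F\<close> lies below \<open>T\<close>.\<close>
        show "S' \<in> F - {T}" if "S \<in> F - {T}" "S \<subseteq> S'" "S' \<subseteq> N" for S S'
          using that up[of S S'] min[of S] by blast
        \<comment> \<open>At \<open>T\<close> the two values cancel. A coalition outside
          \<open>F\<close> cannot contain \<open>T\<close>, by upward closure, so both games vanish
          there.\<close>
        show "w S = 0" if "S \<subseteq> N" "S \<notin> F - {T}" for S
          using that supp[of S] up[OF T, of S] T' by (auto simp: w_def game_diff_def unanimity_game_def)
      qed (fact w)
      moreover have "P ?u" by (rule unanimity[OF T'])
      ultimately have "P (game_add N ?u w)" using add u w by blast
      moreover have "game_add N ?u w = v"
        using v by (auto simp: game_add_def w_def game_diff_def games_def extensional_def fun_eq_iff)
      ultimately show ?thesis by simp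
    qed
  qed
  from this[of "Pow N - {{}}" v] show ?thesis using v by (auto simp: games_def)
qed

lemma game_of_dummies_additive:
  assumes "game_of_dummies N d" "C \<subseteq> N"
  shows "d C = (\<Sum>i\<in>C. d {i})"
proof -
  have d: "(N, d) \<in> games" using assms(1) by (simp add: game_of_dummies_def)
  have "finite C" using d assms(2) by (auto simp: games_def intro: finite_subset)
  then show ?thesis using assms(2)
  proof (induction C)
    case empty
    then show ?case using d by (simp add: games_def)
  next
    case (insert i C)
    then have "dummy_player N d i" "C \<subseteq> N - {i}"
      using assms(1) by (auto simp: game_of_dummies_def)
    then have "d (C \<union> {i}) = d C + d {i}" unfolding dummy_player_def by blast
    then show ?case using insert by simp
  qed
qed

text \<open>A game of dummies is determined by its singletons; thus for a given game the measure is
  determined by its values on singletons.\<close>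

lemma dummy_synergy_eq:
  assumes "dummy_synergy \<psi>" "(N, v) \<in> games" "C \<subseteq> N"
  shows "\<psi> N v C = v C - (\<Sum>i\<in>C. v {i} - \<psi> N v {i})"
proof -
  have "game_of_dummies N (game_diff N v (\<psi> N v))"
    using assms by (auto simp: dummy_synergy_def)
  from game_of_dummies_additive[OF this assms(3)]
  have "v C - \<psi> N v C = (\<Sum>i\<in>C. game_diff N v (\<psi> N v) {i})"
    using assms(3) by (simp add: game_diff_def)
  also have "\<dots> = (\<Sum>i\<in>C. v {i} - \<psi> N v {i})"
    using assms(3) by (intro sum.cong) (auto simp: game_diff_def)
  finally show ?thesis by simp
qed

text \<open>What matters is that the right-hand side does not mention \<open>\<psi>\<close>; the sum
  of \<open>v\<close> can therefore stay unevaluated.\<close>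

lemma unanimity_game_synergy_singleton:
  assumes \<psi>: "\<psi> \<in> synergy_measures" "symmetric_synergy \<psi>" "null_synergy \<psi>" "dummy_synergy \<psi>"
      "normalized_synergy \<psi>"
    and N: "finite N" "N \<noteq> {}" and T: "T \<subseteq> N" "T \<noteq> {}" and i: "i \<in> N"
    and v: "v = unanimity_game N T c"
  shows "v {i} - \<psi> N v {i} =
    (if i \<in> T then (\<Sum>C\<in>Pow N. v C) / (2 ^ (card N - 1) * card T) else 0)"
proof -
  have g: "(N, v) \<in> games" unfolding v by (rule unanimity_game_games[OF N T(2)])
  have v0: "v {} = 0" using g by (simp add: games_def)
  define a where "a k = v {k} - \<psi> N v {k}" for k
  \<comment> \<open>A player outside \<open>T\<close> is null, so adding it to the empty coalition
    keeps the synergy at 0.\<close>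
  have null: "a k = 0" if "k \<in> N - T" for k
  proof -
    have k: "null_player N v k"
      using that T by (auto simp: null_player_def v unanimity_game_def)
    then have "v {k} = v {}" using that by (auto simp: null_player_def)
    moreover have "\<psi> N v {} = \<psi> N v ({} \<union> {k})"
      using \<psi>(3) g k unfolding null_synergy_def by blast
    moreover have "\<psi> N v {} = 0" using \<psi>(1) g by (auto simp: synergy_measures_def)
    ultimately show ?thesis using v0 by (simp add: a_def)
  qed
  have sym: "a k = a l" if "k \<in> T" "l \<in> T" for k l
  proof (cases "k = l")
    case False
    have s: "symmetric_players N v k l"
      using that T False by (auto simp: symmetric_players_def v unanimity_game_def)
    then have "v ({} \<union> {k}) = v ({} \<union> {l})" unfolding symmetric_players_def by blast
    moreover have "\<psi> N v ({} \<union> {k}) = \<psi> N v ({} \<union> {l})"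
      using \<psi>(2) g s unfolding symmetric_synergy_def by blast
    ultimately show ?thesis by (simp add: a_def)
  qed simp
  \<comment> \<open>Normalization is now one linear equation for the common value of
    \<open>a\<close> on \<open>T\<close>.\<close>
  have "0 = (\<Sum>C\<in>Pow N. \<psi> N v C)" using \<psi>(5) g by (auto simp: normalized_synergy_def)
  also have "\<dots> = (\<Sum>C\<in>Pow N. v C - (\<Sum>k\<in>C. a k))"
    using dummy_synergy_eq[OF \<psi>(4) g] by (intro sum.cong) (auto simp: a_def)
  also have "\<dots> = (\<Sum>C\<in>Pow N. v C) - 2 ^ (card N - 1) * (\<Sum>k\<in>N. a k)"
    by (simp add: sum_subtractf sum_coalitions_additive[OF N(1)])
  also have "(\<Sum>k\<in>N. a k) = (\<Sum>k\<in>T. a k)"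
    using N T null by (intro sum.mono_neutral_right) auto
  finally have total: "(\<Sum>C\<in>Pow N. v C) = 2 ^ (card N - 1) * (\<Sum>k\<in>T. a k)" by simp
  have "a i = (\<Sum>C\<in>Pow N. v C) / (2 ^ (card N - 1) * card T)" if iT: "i \<in> T"
  proof -
    have "(\<Sum>k\<in>T. a k) = (\<Sum>k\<in>T. a i)" by (intro sum.cong refl sym[OF _ iT])
    moreover have "0 < card T" using N T by (auto simp: card_gt_0_iff intro: finite_subset)
    ultimately show ?thesis unfolding total by simp
  qed
  then show ?thesis using null i by (simp add: a_def)
qed

text \<open>Two arbitrary measures are compared: they share the singleton formula on unanimity
  games, and additivity carries the agreement to sums. No explicit Shapley value of a unanimity game
  has to be computed.\<close>

theorem synergy_measure_unique:
  assumes \<psi>: "\<psi> \<in> synergy_measures" "symmetric_synergy \<psi>" "null_synergy \<psi>" "dummy_synergy \<psi>"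
      "normalized_synergy \<psi>" "additive_synergy \<psi>"
    and \<chi>: "\<chi> \<in> synergy_measures" "symmetric_synergy \<chi>" "null_synergy \<chi>" "dummy_synergy \<chi>"
      "normalized_synergy \<chi>" "additive_synergy \<chi>"
    and v: "(N, v) \<in> games" and C: "C \<subseteq> N"
  shows "\<psi> N v C = \<chi> N v C"
  using v C
proof (induction v arbitrary: C rule: games_unanimity_induct)
  case (unanimity T c)
  let ?u = "unanimity_game N T c"
  have N: "finite N" "N \<noteq> {}" using v by (auto simp: games_def)
  have g: "(N, ?u) \<in> games" using unanimity by (intro unanimity_game_games[OF N])
  have "(\<Sum>i\<in>C. ?u {i} - \<psi> N ?u {i}) = (\<Sum>i\<in>C. ?u {i} - \<chi> N ?u {i})"
  proof (rule sum.cong[OF refl])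
    fix i assume "i \<in> C"
    then have i: "i \<in> N" using unanimity by auto
    show "?u {i} - \<psi> N ?u {i} = ?u {i} - \<chi> N ?u {i}"
      unfolding unanimity_game_synergy_singleton[OF \<psi>(1-5) N unanimity(1,2) i refl]
        unanimity_game_synergy_singleton[OF \<chi>(1-5) N unanimity(1,2) i refl] ..
  qed
  then show ?case
    using dummy_synergy_eq[OF \<psi>(4) g] dummy_synergy_eq[OF \<chi>(4) g] unanimity(3) by simp
next
  case (add u w)
  have "\<psi> N (game_add N u w) C = \<psi> N u C + \<psi> N w C"
    using \<psi>(6) add unfolding additive_synergy_def by metis
  moreover have "\<chi> N (game_add N u w) C = \<chi> N u C + \<chi> N w C"
    using \<chi>(6) add unfolding additive_synergy_def by metis
  ultimately show ?case using add by simp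
qed

theorem theorem3p2:
  "(synergy_value :: 'a measure_fun) \<in> synergy_measures \<and>
   symmetric_synergy (synergy_value :: 'a measure_fun) \<and>
   null_synergy (synergy_value :: 'a measure_fun) \<and>
   dummy_synergy (synergy_value :: 'a measure_fun) \<and>
   normalized_synergy (synergy_value :: 'a measure_fun) \<and>
   additive_synergy (synergy_value :: 'a measure_fun) \<and>
   (\<forall>\<psi>\<in>(synergy_measures :: 'a measure_fun set).
      symmetric_synergy \<psi> \<and> null_synergy \<psi> \<and> dummy_synergy \<psi> \<and>
      normalized_synergy \<psi> \<and> additive_synergy \<psi> \<longrightarrow>
      (\<forall>(N, v)\<in>games. \<forall>C. C \<subseteq> N \<longrightarrow> \<psi> N v C = synergy_value N v C))"
proof -
  note \<chi> = synergy_value_synergy_measures synergy_value_symmetric synergy_value_null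
    synergy_value_dummy synergy_value_normalized synergy_value_additive
  show ?thesis
    by (intro conjI ballI impI \<chi>) (auto intro: synergy_measure_unique[OF _ _ _ _ _ _ \<chi>])
qed

end
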